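(* Let $G$ be a bipartite multigraph. Then $\omega(L(G)^2) \leq \frac{1}{4}\sigma(G)^2$, where $\sigma(G)=\max_{xy\in E(G)}(d_G(x)+d_G(y))$.
   Context: For a (multi)graph $G$, $L(G)^2$ denotes the square of the line graph of $G$: its vertices are the edges of $G$, and two distinct edges $e,f$ of $G$ are adjacent in $L(G)^2$ if and only if they are at distance at most $1$ in $L(G)$ or at distance $2$ in $L(G)$, i.e. $e$ and $f$ share an end, or some edge of $G$ joins an end of $e$ to an end of $f$. $\omega$ denotes the clique number. Degrees $d_G$ in a multigraph count edges with multiplicity. $\sigma(G)$ is called the Ore-degree of $G$ (taken to be $0$ if $G$ has no edges). *)

theory Defs
  imports Complex_Main "HOL-Library.Extended_Nat"
begin

text \<open>Edges are abstract objects, so parallel edges are distinct elements of the edge set.\<close>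

record ('v, 'e) mgraph =
  vertices :: "'v set"
  edges :: "'e set"
  ends :: "'e \<Rightarrow> 'v set"

locale multigraph =
  fixes G :: "('v, 'e) mgraph"
  assumes finite_vertices: "finite (vertices G)"
    and finite_edges: "finite (edges G)"
    and ends_subset: "e \<in> edges G \<Longrightarrow> ends G e \<subseteq> vertices G"
    and card_ends: "e \<in> edges G \<Longrightarrow> card (ends G e) = 2"

definition bipartite :: "('v, 'e) mgraph \<Rightarrow> bool" where
  "bipartite G \<longleftrightarrow> (\<exists>A B. A \<union> B = vertices G \<and> A \<inter> B = {} \<and>
     (\<forall>e\<in>edges G. \<exists>a\<in>A. \<exists>b\<in>B. ends G e = {a, b}))"

text \<open>There are no loops, so counting incident edges gives the degree with multiplicity.\<close>

definition degree :: "('v, 'e) mgraph \<Rightarrow> 'v \<Rightarrow> nat" where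
  "degree G v = card {e \<in> edges G. v \<in> ends G e}"

definition ore_degree :: "('v, 'e) mgraph \<Rightarrow> nat" where
  "ore_degree G = (if edges G = {} then 0
     else Max {degree G x + degree G y | e x y. e \<in> edges G \<and> ends G e = {x, y}})"

text \<open>A simple graph is a pair of a vertex set and a symmetric, irreflexive adjacency relation
  on it.\<close>

type_synonym 'a sgraph = "'a set \<times> 'a rel"

definition line_graph :: "('v, 'e) mgraph \<Rightarrow> 'e sgraph" where
  "line_graph G = (edges G,
     {(e, f). e \<in> edges G \<and> f \<in> edges G \<and> e \<noteq> f \<and> ends G e \<inter> ends G f \<noteq> {}})"

text \<open>\<^term>\<open>R ^^ n\<close> relates the end points of walks of length \<^term>\<open>n\<close>; the distance
  is \<^term>\<open>\<infinity>\<close> if there is no walk.\<close>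

definition distance :: "'a sgraph \<Rightarrow> 'a \<Rightarrow> 'a \<Rightarrow> enat" where
  "distance H x y = (INF n\<in>{n. (x, y) \<in> snd H ^^ n}. enat n)"

definition graph_square :: "'a sgraph \<Rightarrow> 'a sgraph" where
  "graph_square H = (fst H,
     {(x, y). x \<in> fst H \<and> y \<in> fst H \<and> x \<noteq> y \<and> distance H x y \<le> 2})"

definition clique :: "'a sgraph \<Rightarrow> 'a set \<Rightarrow> bool" where
  "clique H C \<longleftrightarrow> C \<subseteq> fst H \<and> pairwise (\<lambda>x y. (x, y) \<in> snd H) C"

definition clique_number :: "'a sgraph \<Rightarrow> nat" where
  "clique_number H = Max (card ` {C. clique H C})"

end

theory Submission imports Defs begin

text \<open>
  Let \<open>A\<close>, \<open>B\<close> be the sides of \<open>G\<close>, let \<open>C\<close> be a clique, and choose \<open>a \<in> A\<close> incident to the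
  maximum number \<open>k\<close> of edges of \<open>C\<close>. Let \<open>Y \<subseteq> A\<close> consist of the ends of the edges of \<open>C\<close> that
  avoid the neighbourhood of \<open>a\<close>. Every vertex \<open>b\<close> joined to \<open>a\<close> by an edge of \<open>C\<close> is adjacent
  to all of \<open>Y\<close>, so at most \<open>d b - |Y|\<close> edges of \<open>C\<close> meet \<open>b\<close> and avoid \<open>Y\<close>. Summing over the
  edges at \<open>a\<close>, the loss \<open>k |Y|\<close> compensates the at most \<open>k |Y|\<close> edges of \<open>C\<close> that meet \<open>Y\<close>.
  Hence \<open>|C|\<close> is at most the sum of \<open>d b\<close> over the edges \<open>ab\<close> at \<open>a\<close>, which is at most
  \<open>d a (\<sigma> - d a) \<le> \<sigma>\<^sup>2 / 4\<close>.
\<close>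

lemma card_cross_adjacent_le:
  fixes l :: "'e \<Rightarrow> 'a" and r :: "'e \<Rightarrow> 'b"
  assumes fin: "finite E" and sub: "C \<subseteq> E"
    and cross: "\<And>e f. e \<in> C \<Longrightarrow> f \<in> C \<Longrightarrow>
      \<exists>g\<in>E. l g = l e \<and> r g = r f \<or> l g = l f \<and> r g = r e"
    and ore: "\<And>g. g \<in> E \<Longrightarrow> card {e \<in> E. l e = l g} + card {e \<in> E. r e = r g} \<le> s"
  shows "4 * card C \<le> s\<^sup>2"
proof (cases "C = {}")
  case False
  have finC: "finite C" using fin sub finite_subset by blast
  define cdeg where "cdeg x = card {e \<in> C. l e = x}" for x
  obtain a where a: "a \<in> l ` C" and amax: "\<And>x. x \<in> l ` C \<Longrightarrow> cdeg x \<le> cdeg a"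
  proof -
    have fin_img: "finite (cdeg ` l ` C)" using finC by simp
    then have "Max (cdeg ` l ` C) \<in> cdeg ` l ` C" using False by (intro Max_in) auto
    then obtain a where "a \<in> l ` C" "cdeg a = Max (cdeg ` l ` C)" by (metis imageE)
    then show ?thesis using that fin_img by (metis Max_ge imageI)
  qed
  \<comment> \<open>\<open>N\<close> draws on all of \<open>E\<close>, not only \<open>C\<close>,
    and consists of edges, so parallel edges at \<open>a\<close> give separate summands
    below.\<close>
  define N where "N = {g \<in> E. l g = a}"
  define Y where "Y = {l e | e. e \<in> C \<and> r e \<notin> r ` N}"
  define w where "w g = card {e \<in> C. l e \<notin> Y \<and> r e = r g}" for g
  have finN: "finite N" using fin by (simp add: N_def)
  have YC: "Y \<subseteq> l ` C" by (auto simp: Y_def)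
  then have finY: "finite Y" using finC by (meson finite_imageI finite_subset)
  have w_le: "w g \<le> card {e \<in> E. r e = r g}" for g
    unfolding w_def using sub fin by (intro card_mono) auto
  \<comment> \<open>The edges \<open>?T\<close> from \<open>Y\<close> to \<open>r g\<close> are not
    counted by \<open>w g\<close>. Each \<open>y\<close> in \<open>Y\<close> has one: if
    \<open>e\<close> witnesses \<open>y\<close>, no edge joins \<open>a\<close> to
    \<open>r e\<close>, so the cross edge of \<open>e\<close> and \<open>g\<close> must join
    \<open>y\<close> to \<open>r g\<close>.\<close>
  have w_le_C: "w g + card Y \<le> card {e \<in> E. r e = r g}" if g: "g \<in> C" "l g = a" for g
  proof -
    let ?S = "{e \<in> C. l e \<notin> Y \<and> r e = r g}" and ?T = "{h \<in> E. l h \<in> Y \<and> r h = r g}"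
    have "Y \<subseteq> l ` ?T"
    proof
      fix y assume y: "y \<in> Y"
      obtain e where e: "e \<in> C" "l e = y" "r e \<notin> r ` N" using y by (auto simp: Y_def)
      obtain h where h: "h \<in> E" "l h = l e \<and> r h = r g \<or> l h = l g \<and> r h = r e"
        using cross[OF e(1) g(1)] by blast
      have "r h \<in> r ` N" if "l h = l g" using that h(1) g(2) by (simp add: N_def)
      then have "l h = l e \<and> r h = r g" using h(2) e(3) by metis
      with h(1) e(2) y show "y \<in> l ` ?T" by (intro image_eqI[of _ _ h]) auto
    qed
    then have "card Y \<le> card ?T"
      using fin by (intro surj_card_le) auto
    moreover have "card (?S \<union> ?T) = card ?S + card ?T"
      using fin finC by (intro card_Un_disjoint) auto
    moreover have "card (?S \<union> ?T) \<le> card {e \<in> E. r e = r g}"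
      using fin sub by (intro card_mono) auto
    ultimately show ?thesis by (simp add: w_def)
  qed
  have "{e \<in> C. l e \<in> Y} = (\<Union>y\<in>Y. {e \<in> C. l e = y})" by auto
  then have "card {e \<in> C. l e \<in> Y} \<le> (\<Sum>y\<in>Y. cdeg y)"
    unfolding cdeg_def using card_UN_le[OF finY] by metis
  also have "\<dots> \<le> card Y * cdeg a"
    using amax YC by (metis of_nat_id subsetD sum_bounded_above)
  finally have meetY: "card {e \<in> C. l e \<in> Y} \<le> card Y * cdeg a" .
  have "{e \<in> C. l e \<notin> Y} \<subseteq> (\<Union>g\<in>N. {e \<in> C. l e \<notin> Y \<and> r e = r g})"
    by (auto simp: Y_def)
  then have "card {e \<in> C. l e \<notin> Y} \<le> card (\<Union>g\<in>N. {e \<in> C. l e \<notin> Y \<and> r e = r g})"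
    using finN finC by (intro card_mono) auto
  also have "\<dots> \<le> (\<Sum>g\<in>N. w g)"
    unfolding w_def by (rule card_UN_le[OF finN])
  finally have avoidY: "card {e \<in> C. l e \<notin> Y} \<le> (\<Sum>g\<in>N. w g)" .
  \<comment> \<open>Exactly \<open>cdeg a\<close> edges of \<open>N\<close> lie in \<open>C\<close>.
    Each of them leaves room for \<open>card Y\<close> by \<open>w_le_C\<close>; for the others
    \<open>w_le\<close> suffices.\<close>
  have "N \<inter> C = {e \<in> C. l e = a}" using sub by (auto simp: N_def)
  then have "card Y * cdeg a = (\<Sum>g\<in>N. if g \<in> C then card Y else 0)"
    using finN by (simp add: cdeg_def flip: sum.inter_restrict)
  then have "card Y * cdeg a + (\<Sum>g\<in>N. w g) = (\<Sum>g\<in>N. (if g \<in> C then card Y else 0) + w g)"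
    by (simp add: sum.distrib)
  also have "\<dots> \<le> (\<Sum>g\<in>N. card {e \<in> E. r e = r g})"
  proof (rule sum_mono)
    fix g assume "g \<in> N"
    then show "(if g \<in> C then card Y else 0) + w g \<le> card {e \<in> E. r e = r g}"
      using w_le[of g] w_le_C[of g] by (auto simp: N_def)
  qed
  also have "\<dots> \<le> card N * (s - card N)"
  proof -
    have "card {e \<in> E. r e = r g} \<le> s - card N" if "g \<in> N" for g
      using ore[of g] that by (auto simp: N_def)
    then have "(\<Sum>g\<in>N. card {e \<in> E. r e = r g}) \<le> of_nat (card N) * (s - card N)"
      by (rule sum_bounded_above)
    then show ?thesis by simp
  qed
  finally have sum_le: "card Y * cdeg a + (\<Sum>g\<in>N. w g) \<le> card N * (s - card N)" .
  have "C = {e \<in> C. l e \<in> Y} \<union> {e \<in> C. l e \<notin> Y}" by auto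
  then have "card C \<le> card {e \<in> C. l e \<in> Y} + card {e \<in> C. l e \<notin> Y}"
    by (metis card_Un_le)
  with meetY avoidY sum_le have main: "card C \<le> card N * (s - card N)" by linarith
  \<comment> \<open>Some edge of \<open>E\<close> has left end \<open>a\<close>, so
    \<open>ore\<close> applies to it and the subtraction in \<open>main\<close> is not
    truncated.\<close>
  have "card N \<le> s"
    using a ore sub by (force simp: N_def)
  then obtain t where t: "s = card N + t" using le_Suc_ex by blast
  have "4 * (m * n) \<le> (m + n)\<^sup>2" for m n :: nat
    using zero_le_power2[of "int m - int n"]
    by (simp add: power2_eq_square algebra_simps flip: of_nat_mult of_nat_add)
  with main t show ?thesis
    by (metis add_diff_cancel_left' le_trans mult_le_mono2)
qed simp

text \<open>A walk of length 2 has \<open>g\<close> in its middle; for length 1, \<open>g\<close>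
  may be \<open>e\<close> or \<open>f\<close> itself.\<close>

lemma square_line_graph_adjacentD:
  assumes "(e, f) \<in> snd (graph_square (line_graph G))"
  shows "e \<in> edges G" "f \<in> edges G"
    "\<exists>g\<in>edges G. ends G e \<inter> ends G g \<noteq> {} \<and> ends G g \<inter> ends G f \<noteq> {}"
proof -
  from assms show ef: "e \<in> edges G" "f \<in> edges G"
    by (auto simp: graph_square_def line_graph_def)
  let ?R = "snd (line_graph G)"
  have "e \<noteq> f" "distance (line_graph G) e f \<le> enat 2"
    using assms by (auto simp: graph_square_def numeral_eq_enat)
  \<comment> \<open>A strict bound on the infimum yields an actual walk, of length below 3.\<close>
  then have "distance (line_graph G) e f < enat 3"
    by (metis enat_ord_simps(2) order_le_less_trans lessI numeral_3_eq_3 numeral_2_eq_2)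
  then obtain n where n: "(e, f) \<in> ?R ^^ n" "n < 3"
    by (auto simp: distance_def INF_less_iff)
  have "n \<noteq> 0" using n(1) \<open>e \<noteq> f\<close> by (auto intro: gr0I)
  with n(2) consider "n = 1" | "n = 2" by linarith
  then show "\<exists>g\<in>edges G. ends G e \<inter> ends G g \<noteq> {} \<and> ends G g \<inter> ends G f \<noteq> {}"
  proof cases
    case 1
    with n(1) have "ends G e \<inter> ends G f \<noteq> {}" by (auto simp: line_graph_def)
    with ef show ?thesis by blast
  next
    case 2
    with n(1) obtain g where "(e, g) \<in> ?R" "(g, f) \<in> ?R"
      by (auto simp: numeral_2_eq_2)
    then show ?thesis by (auto simp: line_graph_def)
  qed
qed

lemma ore_degree_ge:
  assumes "finite (edges G)" "e \<in> edges G" "ends G e = {x, y}"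
  shows "degree G x + degree G y \<le> ore_degree G"
proof -
  let ?S = "{degree G x + degree G y | e x y. e \<in> edges G \<and> ends G e = {x, y}}"
  have "degree G v \<le> card (edges G)" for v
    unfolding degree_def using assms(1) by (intro card_mono) auto
  then have "?S \<subseteq> {..2 * card (edges G)}"
    by (auto simp: mult_2 intro: add_mono)
  then have "finite ?S" by (rule finite_subset) simp
  moreover have "degree G x + degree G y \<in> ?S" using assms by blast
  ultimately show ?thesis using assms(2) by (auto simp: ore_degree_def intro: Max_ge)
qed

text \<open>Naming the end of each edge in either side reduces this to
  \<open>card_cross_adjacent_le\<close>: degrees become fibre sizes of \<open>l\<close> and
  \<open>r\<close>.\<close>

lemma clique_square_line_graph_card_le:
  assumes "multigraph G" "bipartite G" and C: "clique (graph_square (line_graph G)) C"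
  shows "4 * card C \<le> (ore_degree G)\<^sup>2"
proof -
  interpret multigraph G by fact
  obtain A B where AB: "A \<inter> B = {}"
    and "\<forall>e\<in>edges G. \<exists>a\<in>A. \<exists>b\<in>B. ends G e = {a, b}"
    using assms(2) by (auto simp: bipartite_def)
  then have "\<forall>e. \<exists>p. e \<in> edges G \<longrightarrow> fst p \<in> A \<and> snd p \<in> B \<and> ends G e = {fst p, snd p}"
    by fastforce
  then obtain p where p: "\<And>e. e \<in> edges G \<Longrightarrow>
      fst (p e) \<in> A \<and> snd (p e) \<in> B \<and> ends G e = {fst (p e), snd (p e)}"
    by metis
  define l r where "l e = fst (p e)" and "r e = snd (p e)" for e
  have ends: "ends G e = {l e, r e}" if "e \<in> edges G" for e
    using p[OF that] by (simp add: l_def r_def)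
  have lr_neq: "l e \<noteq> r f" if "e \<in> edges G" "f \<in> edges G" for e f
    using p[OF that(1)] p[OF that(2)] AB by (auto simp: l_def r_def)
  show ?thesis
  proof (rule card_cross_adjacent_le[where E = "edges G" and l = l and r = r])
    show "finite (edges G)" by (rule finite_edges)
    show sub: "C \<subseteq> edges G"
      using C by (auto simp: clique_def graph_square_def line_graph_def)
    show "\<exists>g\<in>edges G. l g = l e \<and> r g = r f \<or> l g = l f \<and> r g = r e"
      if "e \<in> C" "f \<in> C" for e f
    proof (cases "e = f")
      case True
      then show ?thesis using sub that by blast
    next
      case False
      then have "(e, f) \<in> snd (graph_square (line_graph G))"
        using C that by (auto simp: clique_def pairwise_def)
      from square_line_graph_adjacentD[OF this] obtain g where
        E: "e \<in> edges G" "f \<in> edges G" "g \<in> edges G"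
        and "ends G e \<inter> ends G g \<noteq> {}" "ends G g \<inter> ends G f \<noteq> {}" by blast
      \<comment> \<open>Since the sides are disjoint, edges that meet share a left end or a right
        end. If \<open>g\<close> meets \<open>e\<close> and \<open>f\<close> on different sides, it
        is the cross edge; otherwise \<open>e\<close> and \<open>f\<close> share an end and one of
        them serves.\<close>
      then have "l e = l g \<or> r e = r g" "l g = l f \<or> r g = r f"
        using lr_neq[of e g] lr_neq[of g e] lr_neq[of f g] lr_neq[of g f] by (auto simp: ends)
      then show ?thesis using E by metis
    qed
    show "card {e \<in> edges G. l e = l g} + card {e \<in> edges G. r e = r g} \<le> ore_degree G"
      if g: "g \<in> edges G" for g
    proof -
      have "{e \<in> edges G. l g \<in> ends G e} = {e \<in> edges G. l e = l g}"
        using lr_neq[OF g] by (auto simp: ends)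
      moreover have "{e \<in> edges G. r g \<in> ends G e} = {e \<in> edges G. r e = r g}"
        using lr_neq[OF _ g] by (fastforce simp: ends)
      ultimately show ?thesis
        using ore_degree_ge[OF finite_edges g, of "l g" "r g"] ends[OF g]
        by (simp add: degree_def)
    qed
  qed
qed

theorem theorem3:
  fixes G :: "('v, 'e) mgraph"
  assumes "multigraph G"
    and "bipartite G"
  shows "real (clique_number (graph_square (line_graph G))) \<le> 1 / 4 * (real (ore_degree G))\<^sup>2"
proof -
  let ?H = "graph_square (line_graph G)"
  have "{C. clique ?H C} \<subseteq> Pow (edges G)"
    by (auto simp: clique_def graph_square_def line_graph_def)
  then have "finite {C. clique ?H C}"
    using multigraph.finite_edges[OF assms(1)] by (meson finite_Pow_iff finite_subset)
  moreover have "clique ?H {}" by (simp add: clique_def)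
  \<comment> \<open>The empty clique ensures that \<open>Max\<close> is attained.\<close>
  ultimately have "clique_number ?H \<in> card ` {C. clique ?H C}"
    unfolding clique_number_def by (intro Max_in) auto
  then have "4 * clique_number ?H \<le> (ore_degree G)\<^sup>2"
    using clique_square_line_graph_card_le[OF assms] by auto
  then have "real (4 * clique_number ?H) \<le> real ((ore_degree G)\<^sup>2)"
    by (rule of_nat_mono)
  then show ?thesis by simp
qed

end
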